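(* Let $\Gamma$ be a countably infinite group and let $(D_n)_{n \in \mathbb{N}}$ be a sequence of finite subsets of $\Gamma$ such that $|D_n|/\log n \to \infty$. Then, for all continuous functions $f \colon \Omega \to \mathbb{C}$, $$\lim_{n \to \infty} \mathbb{E}_{D_n} f(x) = \mathbb{E}_{\boldsymbol{\lambda}} f \qquad \text{for } \boldsymbol{\lambda}\text{-a.e. } x \in \Omega.$$
   Context: $\Omega = [0;1]^\Gamma$ (the set of all maps $x \colon \Gamma \to [0;1]$ with the product topology) and $\boldsymbol{\lambda} = \lambda^\Gamma$, where $\lambda$ is the Lebesgue probability measure on the unit interval $[0;1]$. The group $\Gamma$ acts on $\Omega$ by the shift action $(\gamma \cdot x)(\delta) = x(\delta\gamma)$ for $x \in \Omega$, $\gamma,\delta \in \Gamma$; it preserves $\boldsymbol{\lambda}$. The global average is $\mathbb{E}_{\boldsymbol{\lambda}} f = \int_\Omega f \, d\boldsymbol{\lambda}$. For a nonempty finite $D \subset \Gamma$, the pointwise average is $\mathbb{E}_D f(x) = \frac{1}{|D|}\sum_{\delta \in D} f(\delta \cdot x)$. (The growth assumption implies $D_n \neq \varnothing$ for all large $n$.) *)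

theory Defs
  imports "HOL-Probability.Probability" "HOL-Algebra.Group"
begin

definition unit_lebesgue :: "real measure" where
  "unit_lebesgue = restrict_space lborel {0..1}"

text \<open>The space \<open>\<Omega> = [0;1]\<^sup>\<Gamma>\<close>. As usual for products over a carrier set, its points are
  extensional functions: they take the value \<^const>\<open>undefined\<close> outside \<^term>\<open>carrier \<Gamma>\<close>.\<close>

definition Omega_top :: "('g, 'm) monoid_scheme \<Rightarrow> ('g \<Rightarrow> real) topology" where
  "Omega_top \<Gamma> = product_topology (\<lambda>_. top_of_set {0..1}) (carrier \<Gamma>)"

definition Omega_measure :: "('g, 'm) monoid_scheme \<Rightarrow> ('g \<Rightarrow> real) measure" where
  "Omega_measure \<Gamma> = (\<Pi>\<^sub>M _\<in>carrier \<Gamma>. unit_lebesgue)"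

definition shift :: "('g, 'm) monoid_scheme \<Rightarrow> 'g \<Rightarrow> ('g \<Rightarrow> real) \<Rightarrow> 'g \<Rightarrow> real" where
  "shift \<Gamma> \<gamma> x = (\<lambda>\<delta>\<in>carrier \<Gamma>. x (\<delta> \<otimes>\<^bsub>\<Gamma>\<^esub> \<gamma>))"

text \<open>This is only meaningful for nonempty finite \<open>D\<close>; for empty \<open>D\<close> the value is \<open>0\<close>.\<close>

definition pointwise_avg ::
  "('g, 'm) monoid_scheme \<Rightarrow> 'g set \<Rightarrow> (('g \<Rightarrow> real) \<Rightarrow> complex) \<Rightarrow> ('g \<Rightarrow> real) \<Rightarrow> complex" where
  "pointwise_avg \<Gamma> D f x = 1 / of_nat (card D) * (\<Sum>\<delta>\<in>D. f (shift \<Gamma> \<delta> x))"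

definition global_avg ::
  "('g, 'm) monoid_scheme \<Rightarrow> (('g \<Rightarrow> real) \<Rightarrow> complex) \<Rightarrow> complex" where
  "global_avg \<Gamma> f = (\<integral>x. f x \<partial>Omega_measure \<Gamma>)"

lemma prob_space_unit_lebesgue: "prob_space unit_lebesgue"
  by (rule prob_spaceI) (simp add: unit_lebesgue_def space_restrict_space emeasure_restrict_space)

lemma prob_space_Omega_measure: "prob_space (Omega_measure \<Gamma>)"
  unfolding Omega_measure_def by (intro prob_space_PiM prob_space_unit_lebesgue)

lemma space_Omega_measure: "space (Omega_measure \<Gamma>) = topspace (Omega_top \<Gamma>)"
  by (simp add: Omega_measure_def Omega_top_def space_PiM unit_lebesgue_def space_restrict_space)

lemma (in group) shift_in_Omega:
  assumes "\<gamma> \<in> carrier G" "x \<in> topspace (Omega_top G)"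
  shows "shift G \<gamma> x \<in> topspace (Omega_top G)"
  using assms by (auto simp: Omega_top_def shift_def PiE_iff)

lemma (in group) shift_mult:
  assumes "\<gamma> \<in> carrier G" "\<eta> \<in> carrier G"
  shows "shift G (\<gamma> \<otimes> \<eta>) x = shift G \<gamma> (shift G \<eta> x)"
  using assms by (auto simp: shift_def m_assoc intro!: restrict_ext)

end

theory Submission
  imports Defs
begin

text \<open>By compactness, \<open>f\<close> is a uniform limit of finite-valued functions \<open>g\<close>, each depending only on the
  coordinates in a finite set \<open>F\<close>. The value of \<open>g\<close> at \<open>\<delta> \<cdot> x\<close> then depends only on the coordinates of
  \<open>x\<close> in \<open>F\<delta>\<close>, and each \<open>F\<delta>\<close> meets at most \<open>|F|\<^sup>2\<close> others. Hence \<open>D\<^sub>n\<close> splits into boundedly many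
  classes on which these values are independent, and Hoeffding's inequality shows that the average of
  \<open>g\<close> over \<open>D\<^sub>n\<close> deviates from its mean by \<open>\<epsilon>\<close> with probability at most \<open>C exp (- c |D\<^sub>n|)\<close>. Since
  \<open>|D\<^sub>n| / ln n\<close> tends to infinity, this is eventually at most \<open>C / n\<^sup>2\<close>, and Borel-Cantelli applies.\<close>

section \<open>Concentration for sums with a dependency graph of bounded degree\<close>

text \<open>Vertices are coloured one at a time: the new vertex \<open>a\<close> has fewer than
  \<open>k\<close> neighbours, so their colours cannot exhaust \<open>{..<k}\<close> and a free
  colour \<open>m\<close> remains. Symmetry of \<open>R\<close> lets the bound on the neighbours in
  one direction protect \<open>a\<close> in both.\<close>

lemma greedy_colouring:
  fixes R :: "'a \<Rightarrow> 'a \<Rightarrow> bool" and k :: nat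
  assumes "finite D" and sym: "\<And>u v. R u v \<Longrightarrow> R v u"
    and deg: "\<And>v. v \<in> D \<Longrightarrow> card {u \<in> D. u \<noteq> v \<and> R u v} < k"
  shows "\<exists>c. c ` D \<subseteq> {..<k} \<and> (\<forall>u\<in>D. \<forall>v\<in>D. u \<noteq> v \<longrightarrow> R u v \<longrightarrow> c u \<noteq> c v)"
  using assms(1) deg
proof (induction D rule: finite_induct)
  case empty
  then show ?case by auto
next
  case (insert a D)
  have "card {u \<in> D. u \<noteq> v \<and> R u v} < k" if "v \<in> D" for v
  proof -
    have "card {u \<in> D. u \<noteq> v \<and> R u v} \<le> card {u \<in> insert a D. u \<noteq> v \<and> R u v}"
      using insert.hyps by (intro card_mono) auto
    then show ?thesis using insert.prems[of v] that by auto
  qed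
  then have "\<exists>c. c ` D \<subseteq> {..<k} \<and> (\<forall>u\<in>D. \<forall>v\<in>D. u \<noteq> v \<longrightarrow> R u v \<longrightarrow> c u \<noteq> c v)"
    by (rule insert.IH)
  then obtain c where c: "c ` D \<subseteq> {..<k}"
    "\<And>u v. u \<in> D \<Longrightarrow> v \<in> D \<Longrightarrow> u \<noteq> v \<Longrightarrow> R u v \<Longrightarrow> c u \<noteq> c v"
    by (elim exE conjE) blast
  let ?N = "{u \<in> insert a D. u \<noteq> a \<and> R u a}"
  have "card (c ` ?N) < card {..<k}"
    using card_image_le[of ?N c] insert.hyps insert.prems[of a] by auto
  then obtain m where m: "m < k" "m \<notin> c ` ?N"
    using insert.hyps(1) card_mono[of "c ` ?N" "{..<k}"] by force
  have away: "c u \<noteq> m" if "u \<in> D" "R u a \<or> R a u" for u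
    using m(2) that insert.hyps sym by blast
  show ?case
  proof (intro exI[of _ "c(a := m)"] conjI ballI impI)
    show "(c(a := m)) ` insert a D \<subseteq> {..<k}" using c(1) m(1) by auto
    show "(c(a := m)) u \<noteq> (c(a := m)) v"
      if "u \<in> insert a D" "v \<in> insert a D" "u \<noteq> v" "R u v" for u v
      using that c(2)[of u v] away[of u] away[of v] by (auto split: if_splits)
  qed
qed

text \<open>Each colour class of a proper \<open>k\<close>-colouring of the dependency graph is an independent family.
  If the sum deviates by \<open>\<epsilon> * card D\<close>, then the sum over some class deviates by \<open>\<epsilon> * card D / k\<close>.\<close>

lemma (in prob_space) Hoeffding_dependency_graph:
  fixes X :: "'b \<Rightarrow> 'a \<Rightarrow> real" and R :: "'b \<Rightarrow> 'b \<Rightarrow> bool"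
    and B \<epsilon> :: real and k :: nat
  assumes D: "finite D" "D \<noteq> {}" and sym: "\<And>u v. R u v \<Longrightarrow> R v u"
    and deg: "\<And>v. v \<in> D \<Longrightarrow> card {u \<in> D. u \<noteq> v \<and> R u v} < k"
    and indep: "\<And>S. S \<subseteq> D \<Longrightarrow> S \<noteq> {} \<Longrightarrow> (\<And>u v. u \<in> S \<Longrightarrow> v \<in> S \<Longrightarrow> u \<noteq> v \<Longrightarrow> \<not> R u v) \<Longrightarrow>
                  indep_vars (\<lambda>_. borel) X S"
    and bound: "\<And>i. i \<in> D \<Longrightarrow> AE x in M. \<bar>X i x\<bar> \<le> B"
    and "B > 0" "\<epsilon> > 0"
  shows "prob {x \<in> space M. \<bar>(\<Sum>i\<in>D. X i x) - (\<Sum>i\<in>D. expectation (X i))\<bar> \<ge> \<epsilon> * card D}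
         \<le> 2 * real k * exp (- \<epsilon>\<^sup>2 / (2 * (real k)\<^sup>2 * B\<^sup>2) * card D)"
proof -
  obtain c where c: "c ` D \<subseteq> {..<k}"
    "\<And>u v. u \<in> D \<Longrightarrow> v \<in> D \<Longrightarrow> u \<noteq> v \<Longrightarrow> R u v \<Longrightarrow> c u \<noteq> c v"
    using greedy_colouring[OF D(1) sym deg] by metis
  have k: "k > 0" using c(1) D(2) by auto
  have dpos: "real (card D) > 0" using D by (simp add: card_gt_0_iff)
  define S where "S = (\<lambda>j. {i \<in> D. c i = j})"
  define A where "A = (\<lambda>j. {x \<in> space M. \<bar>(\<Sum>i\<in>S j. X i x) - (\<Sum>i\<in>S j. expectation (X i))\<bar>
                                \<ge> \<epsilon> * card D / k})"
  let ?b = "exp (- \<epsilon>\<^sup>2 / (2 * (real k)\<^sup>2 * B\<^sup>2) * card D)"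
  \<comment> \<open>Measurability of each \<open>X i\<close> is contained in \<open>indep\<close>: a
    singleton has no two distinct related points.\<close>
  have meas[measurable]: "random_variable borel (X i)" if "i \<in> D" for i
    using indep[of "{i}"] that by (auto simp: indep_vars_def)
  have fS: "finite (S j)" "S j \<subseteq> D" for j using D by (auto simp: S_def)
  have A_ev: "A j \<in> events" for j
  proof -
    have [measurable]: "random_variable borel (\<lambda>x. \<Sum>i\<in>S j. X i x)"
      using fS(2)[of j] by (intro borel_measurable_sum meas) auto
    show ?thesis unfolding A_def by measurable
  qed
  have split: "(\<Sum>i\<in>D. h i) = (\<Sum>j<k. \<Sum>i\<in>S j. h i)" for h :: "'b \<Rightarrow> real"
    unfolding S_def using sum.group[OF D(1) finite_lessThan c(1), of h] by simp
  have sub: "{x \<in> space M. \<bar>(\<Sum>i\<in>D. X i x) - (\<Sum>i\<in>D. expectation (X i))\<bar> \<ge> \<epsilon> * card D}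
        \<subseteq> (\<Union>j<k. A j)"
  proof (rule subsetI, rule ccontr)
    fix x assume x: "x \<in> {x \<in> space M. \<bar>(\<Sum>i\<in>D. X i x) - (\<Sum>i\<in>D. expectation (X i))\<bar> \<ge> \<epsilon> * card D}"
      and nx: "x \<notin> (\<Union>j<k. A j)"
    have lt: "\<bar>(\<Sum>i\<in>S j. X i x) - (\<Sum>i\<in>S j. expectation (X i))\<bar> < \<epsilon> * card D / k" if "j < k" for j
      using x nx that unfolding A_def by force
    have "\<bar>(\<Sum>i\<in>D. X i x) - (\<Sum>i\<in>D. expectation (X i))\<bar>
        \<le> (\<Sum>j<k. \<bar>(\<Sum>i\<in>S j. X i x) - (\<Sum>i\<in>S j. expectation (X i))\<bar>)"
      unfolding split by (simp flip: sum_subtractf)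
    also have "\<dots> < (\<Sum>j<k. \<epsilon> * card D / k)"
      using lt k by (intro sum_strict_mono) auto
    also have "\<dots> = \<epsilon> * card D" using k by simp
    finally show False using x by auto
  qed
  have colour_class: "prob (A j) \<le> 2 * ?b" for j
  proof (cases "S j = {}")
    \<comment> \<open>The Hoeffding exponent has \<open>card (S j)\<close> in its denominator, so an
      empty class is treated apart: its deviation 0 lies below the positive threshold.\<close>
    case True
    then have "A j = {}"
      using assms(8) dpos k by (auto simp: A_def not_le field_simps intro!: mult_pos_pos)
    then show ?thesis by simp
  next
    case False
    interpret H: Hoeffding_ineq M "S j" X "\<lambda>_. -B" "\<lambda>_. B" "\<Sum>i\<in>S j. expectation (X i)"
    proof (unfold_locales)
      show "finite (S j)" by fact
      show "indep_vars (\<lambda>_. borel) X (S j)"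
      proof (intro indep)
        show "\<not> R u v" if "u \<in> S j" "v \<in> S j" "u \<noteq> v" for u v
          using c(2)[of u v] that by (auto simp: S_def)
      qed (use fS False in auto)
      show "AE x in M. X i x \<in> {-B..B}" if "i \<in> S j" for i
        using bound[of i] that fS(2) by (force elim!: eventually_mono)
    qed
    have cS: "real (card (S j)) > 0" "card (S j) \<le> card D"
      using False fS[of j] D by (auto simp: card_gt_0_iff intro: card_mono)
    \<comment> \<open>Enlarging \<open>card (S j)\<close> to \<open>card D\<close> in the
      denominator weakens the exponent but makes it the same for all classes; one of the two factors
      \<open>card D\<close> in the numerator then cancels.\<close>
    have le: "\<epsilon>\<^sup>2 / (2 * (real k)\<^sup>2 * B\<^sup>2) * card D \<le> 2 * (\<epsilon> * card D / k)\<^sup>2 / (card (S j) * (2 * B)\<^sup>2)"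
    proof -
      have "2 * (\<epsilon> * card D / k)\<^sup>2 / (card D * (2 * B)\<^sup>2) \<le> 2 * (\<epsilon> * card D / k)\<^sup>2 / (card (S j) * (2 * B)\<^sup>2)"
        using cS assms(7) dpos by (intro divide_left_mono mult_right_mono mult_pos_pos) auto
      moreover have "2 * (\<epsilon> * card D / k)\<^sup>2 / (card D * (2 * B)\<^sup>2) = \<epsilon>\<^sup>2 / (2 * (real k)\<^sup>2 * B\<^sup>2) * card D"
        using dpos k assms(7) by (simp add: field_simps power2_eq_square)
      ultimately show ?thesis by simp
    qed
    have "prob (A j) \<le> 2 * exp (-2 * (\<epsilon> * card D / k)\<^sup>2 / (\<Sum>i\<in>S j. (B - - B)\<^sup>2))"
      unfolding A_def using cS assms(7,8) dpos
      by (intro H.Hoeffding_ineq_abs_ge) auto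
    also have "\<dots> \<le> 2 * ?b" using le by simp
    finally show ?thesis .
  qed
  have "prob {x \<in> space M. \<bar>(\<Sum>i\<in>D. X i x) - (\<Sum>i\<in>D. expectation (X i))\<bar> \<ge> \<epsilon> * card D}
        \<le> prob (\<Union>j<k. A j)"
    using sub A_ev by (intro finite_measure_mono) auto
  also have "\<dots> \<le> (\<Sum>j<k. prob (A j))"
    using A_ev by (intro finite_measure_subadditive_finite) auto
  also have "\<dots> \<le> (\<Sum>j<k. 2 * ?b)" by (intro sum_mono colour_class)
  finally show ?thesis by (simp add: mult.commute mult.left_commute)
qed

section \<open>Independence of functions of disjoint sets of coordinates\<close>

text \<open>Coordinates are independent under a product measure, hence so are the restrictions of a
  point to the disjoint sets \<open>K j\<close>. By \<open>supp\<close>, each \<open>X j\<close>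
  factors through its restriction.\<close>

lemma indep_vars_PiM_disjoint_support:
  fixes X :: "'j \<Rightarrow> ('i \<Rightarrow> 'a) \<Rightarrow> 'b"
  assumes M: "\<And>i. i \<in> I \<Longrightarrow> prob_space (M i)"
    and X: "\<And>j. j \<in> J \<Longrightarrow> X j \<in> measurable (PiM I M) (N j)"
    and K: "\<And>j. j \<in> J \<Longrightarrow> K j \<subseteq> I" "disjoint_family_on K J"
    and supp: "\<And>j x y. j \<in> J \<Longrightarrow> x \<in> space (PiM I M) \<Longrightarrow> y \<in> space (PiM I M) \<Longrightarrow>
                 (\<And>i. i \<in> K j \<Longrightarrow> x i = y i) \<Longrightarrow> X j x = X j y"
  shows "prob_space.indep_vars (PiM I M) N X J"
proof -
  interpret P: prob_space "PiM I M" by (intro prob_space_PiM M)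
  obtain z where z: "z \<in> space (PiM I M)" using P.not_empty by blast
  \<comment> \<open>An arbitrary point \<open>z\<close> fills the coordinates outside
    \<open>K j\<close>, which turns a partial point back into one at which \<open>X j\<close> can be
    evaluated.\<close>
  define E where "E = (\<lambda>j w. \<lambda>i\<in>I. if i \<in> K j then w i else z i)"
  have E[measurable]: "E j \<in> measurable (PiM (K j) M) (PiM I M)" if "j \<in> J" for j
    unfolding E_def
  proof (rule measurable_restrict)
    fix i assume i: "i \<in> I"
    have "z i \<in> space (M i)" using z i by (auto simp: space_PiM PiE_iff)
    then show "(\<lambda>w. if i \<in> K j then w i else z i) \<in> measurable (PiM (K j) M) (M i)"
      by (cases "i \<in> K j") auto
  qed
  \<comment> \<open>The joint law of the coordinates is the product measure itself, and its
    marginals are the \<open>M i\<close>. This criterion for independence is applied to a nonempty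
    index set only.\<close>
  have "P.indep_vars M (\<lambda>i x. x i) I"
  proof (cases "I = {}")
    case True
    then show ?thesis unfolding P.indep_vars_def P.indep_sets_def by auto
  next
    case False
    have "distr (PiM I M) (PiM I M) (\<lambda>x. \<lambda>i\<in>I. x i) = distr (PiM I M) (PiM I M) (\<lambda>x. x)"
      by (intro distr_cong) (auto simp: space_PiM)
    also have "\<dots> = PiM I M" by (rule distr_id)
    also have "\<dots> = PiM I (\<lambda>i. distr (PiM I M) (M i) (\<lambda>x. x i))"
      using distr_PiM_component[of I M] M by (intro PiM_cong) auto
    finally show ?thesis
      using False by (subst P.indep_vars_iff_distr_eq_PiM') auto
  qed
  from P.indep_vars_restrict[OF this K]
  have "P.indep_vars (\<lambda>j. PiM (K j) M) (\<lambda>j x. restrict x (K j)) J" by simp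
  then have "P.indep_vars N (\<lambda>j x. X j (E j (restrict x (K j)))) J"
  proof (rule P.indep_vars_compose2)
    fix j assume "j \<in> J"
    then show "(\<lambda>w. X j (E j w)) \<in> measurable (PiM (K j) M) (N j)"
      by (intro measurable_compose[OF E X])
  qed
  moreover have "X j x = X j (E j (restrict x (K j)))" if "j \<in> J" "x \<in> space (PiM I M)" for j x
  proof (rule supp)
    have "restrict x (K j) \<in> space (PiM (K j) M)"
      using that K(1)[of j] by (auto simp: space_PiM PiE_iff)
    then show "E j (restrict x (K j)) \<in> space (PiM I M)"
      using measurable_space[OF E] that by blast
    show "x i = E j (restrict x (K j)) i" if "i \<in> K j" for i
      using that K(1)[of j] \<open>j \<in> J\<close> by (auto simp: E_def)
  qed (use that in auto)
  \<comment> \<open>\<open>X j\<close> and its factored form are only known to agree on the space.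
    That suffices, since independence sees only preimages intersected with the space.\<close>
  then have "{X j -` A \<inter> space (PiM I M) |A. A \<in> sets (N j)}
      = {(\<lambda>x. X j (E j (restrict x (K j)))) -` A \<inter> space (PiM I M) |A. A \<in> sets (N j)}"
    if "j \<in> J" for j
    using that by (intro Collect_cong ex_cong1 conj_cong refl arg_cong[where f = "(=) _"]) auto
  ultimately show ?thesis
    using X unfolding P.indep_vars_def2 by (simp cong: P.indep_sets_cong)
qed

section \<open>Approximation of continuous functions by cylinder functions\<close>

text \<open>Each point has a basic open box on which \<open>f\<close> stays within \<open>e\<close>
  of its value there, and by compactness finitely many boxes cover the space. Let \<open>g\<close>
  take at \<open>y\<close> the value of \<open>f\<close> at the centre of a box containing
  \<open>y\<close>. Which boxes contain \<open>y\<close> is decided by the finitely many coordinates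
  that they restrict.\<close>

lemma continuous_map_cylinder_approx:
  fixes f :: "('i \<Rightarrow> 'a) \<Rightarrow> 'b::metric_space"
  assumes comp: "compact_space (product_topology T I)"
    and cont: "continuous_map (product_topology T I) euclidean f"
    and space: "\<And>i. i \<in> I \<Longrightarrow> space (M i) = topspace (T i)"
    and sets: "\<And>i U. i \<in> I \<Longrightarrow> openin (T i) U \<Longrightarrow> U \<in> sets (M i)"
    and e: "e > 0"
  obtains g F where "finite F" "F \<subseteq> I" "g \<in> borel_measurable (PiM I M)"
    "finite (g ` space (PiM I M))"
    "\<And>x y. x \<in> space (PiM I M) \<Longrightarrow> y \<in> space (PiM I M) \<Longrightarrow> (\<And>i. i \<in> F \<Longrightarrow> x i = y i) \<Longrightarrow> g x = g y"
    "\<And>x. x \<in> space (PiM I M) \<Longrightarrow> dist (f x) (g x) < e"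
proof -
  let ?O = "topspace (product_topology T I)"
  have O: "space (PiM I M) = ?O" using space by (auto simp: space_PiM PiE_iff)
  have "\<exists>V. x \<in> PiE I V \<and> (\<forall>i. openin (T i) (V i)) \<and> finite {i. V i \<noteq> topspace (T i)}
          \<and> PiE I V \<subseteq> {y \<in> ?O. f y \<in> ball (f x) e}" if "x \<in> ?O" for x
    using cont that e
    by (intro product_topology_open_contains_basis) (auto simp: continuous_map_def)
  then obtain V where "\<forall>x\<in>?O. x \<in> PiE I (V x) \<and> (\<forall>i. openin (T i) (V x i)) \<and>
      finite {i. V x i \<noteq> topspace (T i)} \<and> PiE I (V x) \<subseteq> {y \<in> ?O. f y \<in> ball (f x) e}"
    using bchoice[of ?O "\<lambda>x V. x \<in> PiE I V \<and> (\<forall>i. openin (T i) (V i)) \<and>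
      finite {i. V i \<noteq> topspace (T i)} \<and> PiE I V \<subseteq> {y \<in> ?O. f y \<in> ball (f x) e}"] by blast
  then have V: "\<And>x. x \<in> ?O \<Longrightarrow> x \<in> PiE I (V x)" "\<And>x i. x \<in> ?O \<Longrightarrow> openin (T i) (V x i)"
      "\<And>x. x \<in> ?O \<Longrightarrow> finite {i. V x i \<noteq> topspace (T i)}"
      "\<And>x. x \<in> ?O \<Longrightarrow> PiE I (V x) \<subseteq> {y \<in> ?O. f y \<in> ball (f x) e}"
    by blast+
  define P where "P = (\<lambda>x. PiE I (V x))"
  have "\<exists>\<F>. finite \<F> \<and> \<F> \<subseteq> P ` ?O \<and> ?O \<subseteq> \<Union>\<F>"
    using comp unfolding compact_space_def compactin_def
  proof (elim conjE allE[of _ "P ` ?O"] impE)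
    show "(\<forall>U\<in>P ` ?O. openin (product_topology T I) U) \<and> ?O \<subseteq> \<Union> (P ` ?O)"
      using V(1-3) unfolding P_def by (auto intro!: product_topology_basis simp del: topspace_product_topology)
  qed auto
  then obtain C where C: "finite C" "C \<subseteq> ?O" "?O \<subseteq> \<Union> (P ` C)"
    by (metis finite_subset_image)
  define J where "J = (\<lambda>x. {i \<in> I. V x i \<noteq> topspace (T i)})"
  \<comment> \<open>The centre is chosen from the set \<open>A y\<close> of all eligible centres, so
    \<open>g\<close> depends on \<open>y\<close> through \<open>A y\<close> alone. Measurability and
    finite support of \<open>g\<close> thus reduce to those of \<open>A\<close>.\<close>
  define A where "A = (\<lambda>y. {x \<in> C. y \<in> P x})"
  define g where "g = (\<lambda>y. f (SOME x. x \<in> A y))"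
  have J: "finite (J x)" "J x \<subseteq> I" if "x \<in> C" for x
    using V(3)[of x] C(2) that by (auto simp: J_def elim: rev_finite_subset)
  have P_iff: "y \<in> P x \<longleftrightarrow> (\<forall>i\<in>J x. y i \<in> V x i)" if "x \<in> C" "y \<in> ?O" for x y
    using that unfolding P_def J_def by (auto simp: PiE_iff)
  have P_sets: "P x \<in> sets (PiM I M)" if "x \<in> C" for x
  proof -
    have "P x \<subseteq> ?O" unfolding P_def using V(4) that C(2) by blast
    then have "P x = prod_emb I M (J x) (PiE (J x) (V x))"
      using P_iff[OF that] O by (auto simp: prod_emb_def space_PiM PiE_iff)
    also have "\<dots> \<in> sets (PiM I M)"
      using J[OF that] V(2)[OF subsetD[OF C(2) that]] sets by (intro sets_PiM_I) auto
    finally show ?thesis .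
  qed
  have some: "(SOME x. x \<in> A y) \<in> A y" if "y \<in> ?O" for y
    using C(3) that unfolding some_in_eq A_def by blast
  \<comment> \<open>\<open>A\<close> takes values in the finite set \<open>Pow C\<close>, so it is
    enough that each fibre is measurable; a fibre is a finite intersection of boxes and complements
    of boxes.\<close>
  have A_meas: "A \<in> measurable (PiM I M) (count_space (Pow C))"
    unfolding measurable_count_space_eq2[OF finite_Pow_iff[THEN iffD2, OF C(1)]]
  proof (intro conjI ballI)
    show "A \<in> space (PiM I M) \<rightarrow> Pow C" by (auto simp: A_def)
    fix a assume "a \<in> Pow C"
    then have "A -` {a} \<inter> space (PiM I M) = {y \<in> space (PiM I M). \<forall>x\<in>C. y \<in> P x \<longleftrightarrow> x \<in> a}"
      by (auto simp: A_def)
    also have "\<dots> \<in> sets (PiM I M)"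
      using C(1)
    proof (intro sets.sets_Collect_finite_All)
      fix x assume x: "x \<in> C"
      have "{y \<in> space (PiM I M). y \<in> P x \<longleftrightarrow> x \<in> a}
          = (if x \<in> a then P x else space (PiM I M) - P x)"
        using sets.sets_into_space[OF P_sets[OF x]] by auto
      then show "{y \<in> space (PiM I M). y \<in> P x \<longleftrightarrow> x \<in> a} \<in> sets (PiM I M)"
        using P_sets[OF x] by auto
    qed
    finally show "A -` {a} \<inter> space (PiM I M) \<in> sets (PiM I M)" .
  qed
  show thesis
  proof
    show "finite (\<Union>x\<in>C. J x)" "(\<Union>x\<in>C. J x) \<subseteq> I" using J C by auto
    show "g \<in> borel_measurable (PiM I M)"
      unfolding g_def by (rule measurable_compose[OF A_meas]) simp
    have "g ` space (PiM I M) \<subseteq> f ` C"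
      using some O unfolding g_def A_def by blast
    then show "finite (g ` space (PiM I M))" using C finite_surj by blast
    show "g x = g y" if "x \<in> space (PiM I M)" "y \<in> space (PiM I M)"
      "\<And>i. i \<in> (\<Union>x\<in>C. J x) \<Longrightarrow> x i = y i" for x y
    proof -
      have "x \<in> P z \<longleftrightarrow> y \<in> P z" if "z \<in> C" for z
        using \<open>x \<in> space _\<close> \<open>y \<in> space _\<close> \<open>\<And>i. i \<in> (\<Union>x\<in>C. J x) \<Longrightarrow> x i = y i\<close>
          P_iff[OF that] that unfolding O by (metis UN_I)
      then have "A x = A y" unfolding A_def by blast
      then show ?thesis by (simp add: g_def)
    qed
    show "dist (f x) (g x) < e" if "x \<in> space (PiM I M)" for x
    proof -
      define z where "z = (SOME z. z \<in> A x)"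
      have "z \<in> C" "x \<in> P z" using some[of x] that O unfolding z_def A_def by auto
      then have "dist (f z) (f x) < e"
        using V(4)[of z] C(2) unfolding P_def by auto
      then show ?thesis by (simp add: g_def z_def dist_commute)
    qed
  qed
qed

section \<open>The shift action and tail bounds for cylinder averages\<close>

lemma sets_unit_lebesgue_openin:
  assumes "openin (top_of_set {0..1}) U"
  shows "U \<in> sets unit_lebesgue"
proof -
  obtain T where T: "open T" "U = {0..1} \<inter> T"
    using assms unfolding openin_open by (elim exE conjE)
  have "T \<in> sets lborel" using T(1) by simp
  then show ?thesis unfolding unit_lebesgue_def sets_restrict_space T(2) by (rule imageI)
qed

context group
begin

text \<open>Right multiplication by \<open>\<gamma>\<close> is an injection of the carrier into
  itself, and reindexing a product of identical factors along an injection gives the same product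
  law.\<close>

lemma distr_shift:
  assumes "\<gamma> \<in> carrier G"
  shows "distr (Omega_measure G) (Omega_measure G) (shift G \<gamma>) = Omega_measure G"
  using assms distr_PiM_reindex[of "carrier G" "\<lambda>_. unit_lebesgue" "\<lambda>\<delta>. \<delta> \<otimes> \<gamma>" "carrier G"]
  by (auto simp: Omega_measure_def shift_def[abs_def] prob_space_unit_lebesgue inj_on_def)

lemma measurable_shift:
  assumes "\<gamma> \<in> carrier G"
  shows "shift G \<gamma> \<in> measurable (Omega_measure G) (Omega_measure G)"
  using assms unfolding Omega_measure_def shift_def
  by (intro measurable_restrict) auto

text \<open>The summand at \<open>\<delta>\<close> reads only the coordinates in the translate
  \<open>K \<delta>\<close> of \<open>F\<close>, so summands with disjoint translates are
  independent and the dependency graph joins translates that meet. Shift invariance gives all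
  summands the same mean. The extra 1 in \<open>k\<close> makes the degree bound strict.\<close>

lemma cylinder_avg_tail_bound:
  fixes g :: "('a \<Rightarrow> real) \<Rightarrow> real" and B \<epsilon> :: real
  assumes D: "finite D" "D \<noteq> {}" "D \<subseteq> carrier G"
    and g: "g \<in> borel_measurable (Omega_measure G)"
    and bound: "\<And>x. x \<in> space (Omega_measure G) \<Longrightarrow> \<bar>g x\<bar> \<le> B"
    and F: "finite F" "F \<subseteq> carrier G"
    and supp: "\<And>x y. x \<in> space (Omega_measure G) \<Longrightarrow> y \<in> space (Omega_measure G) \<Longrightarrow>
                 (\<And>i. i \<in> F \<Longrightarrow> x i = y i) \<Longrightarrow> g x = g y"
    and pos: "B > 0" "\<epsilon> > 0"
  defines "k \<equiv> (card F)\<^sup>2 + 1"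
  shows "measure (Omega_measure G) {x \<in> space (Omega_measure G).
           \<bar>(\<Sum>\<delta>\<in>D. g (shift G \<delta> x)) - card D * (\<integral>x. g x \<partial>Omega_measure G)\<bar> \<ge> \<epsilon> * card D}
         \<le> 2 * real k * exp (- \<epsilon>\<^sup>2 / (2 * (real k)\<^sup>2 * B\<^sup>2) * card D)"
proof -
  interpret P: prob_space "Omega_measure G" by (rule prob_space_Omega_measure)
  define K where "K = (\<lambda>\<delta>. (\<lambda>\<phi>. \<phi> \<otimes> \<delta>) ` F)"
  have shift_space: "shift G \<delta> x \<in> space (Omega_measure G)"
    if "\<delta> \<in> carrier G" "x \<in> space (Omega_measure G)" for \<delta> x
    using shift_in_Omega that by (simp add: space_Omega_measure)
  have meas: "(\<lambda>x. g (shift G \<delta> x)) \<in> borel_measurable (Omega_measure G)" if "\<delta> \<in> carrier G" for \<delta>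
    by (rule measurable_compose[OF measurable_shift[OF that] g])
  have E: "(\<integral>x. g (shift G \<delta> x) \<partial>Omega_measure G) = (\<integral>x. g x \<partial>Omega_measure G)"
    if "\<delta> \<in> carrier G" for \<delta>
    using integral_distr[OF measurable_shift[OF that] g] distr_shift[OF that] by simp
  have "P.prob {x \<in> space (Omega_measure G). \<bar>(\<Sum>\<delta>\<in>D. g (shift G \<delta> x))
            - (\<Sum>\<delta>\<in>D. P.expectation (\<lambda>x. g (shift G \<delta> x)))\<bar> \<ge> \<epsilon> * card D}
         \<le> 2 * real k * exp (- \<epsilon>\<^sup>2 / (2 * (real k)\<^sup>2 * B\<^sup>2) * card D)"
  proof (rule P.Hoeffding_dependency_graph[where R = "\<lambda>u v. K u \<inter> K v \<noteq> {}"])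
    show "card {u \<in> D. u \<noteq> v \<and> K u \<inter> K v \<noteq> {}} < k" if "v \<in> D" for v
    proof -
      \<comment> \<open>A neighbour \<open>u\<close> of \<open>v\<close> satisfies
        \<open>a \<otimes> u = b \<otimes> v\<close> for some \<open>a\<close>, \<open>b\<close> in
        \<open>F\<close>, and this pair determines \<open>u\<close>.\<close>
      have "{u \<in> D. u \<noteq> v \<and> K u \<inter> K v \<noteq> {}} \<subseteq> (\<lambda>(a, b). inv a \<otimes> (b \<otimes> v)) ` (F \<times> F)"
      proof
        fix u assume "u \<in> {u \<in> D. u \<noteq> v \<and> K u \<inter> K v \<noteq> {}}"
        then obtain a b where ab: "u \<in> D" "a \<in> F" "b \<in> F" "a \<otimes> u = b \<otimes> v" by (auto simp: K_def)
        then have "u = inv a \<otimes> (b \<otimes> v)"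
          using F D that by (metis inv_solve_left' m_closed subsetD)
        then show "u \<in> (\<lambda>(a, b). inv a \<otimes> (b \<otimes> v)) ` (F \<times> F)" using ab by auto
      qed
      then have "card {u \<in> D. u \<noteq> v \<and> K u \<inter> K v \<noteq> {}} \<le> card (F \<times> F)"
        using F by (meson card_image_le card_mono finite_SigmaI finite_imageI le_trans)
      then show ?thesis by (simp add: k_def card_cartesian_product power2_eq_square)
    qed
    show "P.indep_vars (\<lambda>_. borel) (\<lambda>\<delta> x. g (shift G \<delta> x)) S"
      if S: "S \<subseteq> D" "\<And>u v. u \<in> S \<Longrightarrow> v \<in> S \<Longrightarrow> u \<noteq> v \<Longrightarrow> \<not> K u \<inter> K v \<noteq> {}" for S
      unfolding Omega_measure_def
    proof (rule indep_vars_PiM_disjoint_support[where K = K])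
      show "K j \<subseteq> carrier G" if "j \<in> S" for j
        using that S(1) D(3) F(2) by (auto simp: K_def intro!: m_closed)
      show "disjoint_family_on K S" using S(2) by (auto simp: disjoint_family_on_def)
      show "(\<lambda>x. g (shift G j x)) \<in> borel_measurable (PiM (carrier G) (\<lambda>_. unit_lebesgue))"
        if "j \<in> S" for j using meas that S D by (auto simp: Omega_measure_def)
      show "g (shift G j x) = g (shift G j y)"
        if "j \<in> S" "x \<in> space (PiM (carrier G) (\<lambda>_. unit_lebesgue))"
          "y \<in> space (PiM (carrier G) (\<lambda>_. unit_lebesgue))" "\<And>i. i \<in> K j \<Longrightarrow> x i = y i" for j x y
      proof (rule supp)
        have j: "j \<in> carrier G" using that S D by auto
        show "shift G j x \<in> space (Omega_measure G)" "shift G j y \<in> space (Omega_measure G)"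
          using shift_space[OF j] that by (auto simp: Omega_measure_def)
        show "shift G j x i = shift G j y i" if "i \<in> F" for i
          using that F \<open>\<And>i. i \<in> K j \<Longrightarrow> x i = y i\<close> by (auto simp: shift_def K_def)
      qed
    qed (rule prob_space_unit_lebesgue)
    show "AE x in Omega_measure G. \<bar>g (shift G \<delta> x)\<bar> \<le> B" if "\<delta> \<in> D" for \<delta>
      using that D by (intro AE_I2 bound shift_space) auto
  qed (use D(1,2) pos in auto)
  moreover have "(\<Sum>\<delta>\<in>D. P.expectation (\<lambda>x. g (shift G \<delta> x))) = card D * P.expectation g"
    using E D by (simp add: subset_iff)
  ultimately show ?thesis by simp
qed

end

section \<open>From tail bounds to almost everywhere convergence\<close>

text \<open>Once the ratio exceeds \<open>2 / c\<close>, the exponent is at most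
  \<open>- 2 * ln n\<close>. The positivity of \<open>a n\<close> is recorded because, for
  \<open>a n = card (D n)\<close>, it makes the sets nonempty and division by their size
  legitimate.\<close>

lemma eventually_exp_le_inverse_square:
  fixes a :: "nat \<Rightarrow> real"
  assumes "filterlim (\<lambda>n. a n / ln (real n)) at_top sequentially" "c > 0"
  shows "\<forall>\<^sub>F n in sequentially. a n > 0 \<and> exp (- c * a n) \<le> inverse (real n ^ 2)"
proof -
  have "\<forall>\<^sub>F n in sequentially. a n / ln (real n) \<ge> 2 / c"
    using assms(1) by (simp add: filterlim_at_top)
  then show ?thesis
    using eventually_ge_at_top[of 2]
  proof eventually_elim
    case (elim n)
    have ln: "ln (real n) > 0" using elim by simp
    then have ge: "a n \<ge> 2 / c * ln (real n)" using elim by (simp add: field_simps)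
    have "exp (- c * a n) \<le> exp (- (2 * ln (real n)))"
      using ge assms(2) by (simp add: field_simps)
    also have "\<dots> = inverse (real n ^ 2)"
      using elim by (simp add: exp_minus exp_double)
    finally have "exp (- c * a n) \<le> inverse (real n ^ 2)" .
    moreover have "2 / c * ln (real n) > 0" using ln assms(2) by simp
    ultimately show ?case using ge by linarith
  qed
qed

text \<open>For each fixed tolerance the deviation probabilities are summable, so by Borel-Cantelli
  almost every point deviates only finitely often. Tolerances tending to 0 along a sequence then
  give convergence.\<close>

lemma AE_cylinder_avg_tendsto:
  fixes g :: "('g \<Rightarrow> real) \<Rightarrow> real" and G :: "('g, 'm) monoid_scheme"
  assumes "group G"
    and D: "\<And>n. finite (D n)" "\<And>n. D n \<subseteq> carrier G"
    and growth: "filterlim (\<lambda>n. real (card (D n)) / ln (real n)) at_top sequentially"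
    and g: "g \<in> borel_measurable (Omega_measure G)" "finite (g ` space (Omega_measure G))"
    and F: "finite F" "F \<subseteq> carrier G"
    and supp: "\<And>x y. x \<in> space (Omega_measure G) \<Longrightarrow> y \<in> space (Omega_measure G) \<Longrightarrow>
                 (\<And>i. i \<in> F \<Longrightarrow> x i = y i) \<Longrightarrow> g x = g y"
  shows "AE x in Omega_measure G.
           (\<lambda>n. (\<Sum>\<delta>\<in>D n. g (shift G \<delta> x)) / card (D n)) \<longlonglongrightarrow> (\<integral>x. g x \<partial>Omega_measure G)"
proof -
  interpret group G by fact
  interpret P: prob_space "Omega_measure G" by (rule prob_space_Omega_measure)
  define \<mu> where "\<mu> = (\<integral>x. g x \<partial>Omega_measure G)"
  obtain B where B: "B > 0" "\<And>x. x \<in> space (Omega_measure G) \<Longrightarrow> \<bar>g x\<bar> \<le> B"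
  proof -
    obtain b where "\<forall>y\<in>g ` space (Omega_measure G). norm y \<le> b"
      using finite_imp_bounded[OF g(2)] by (auto simp: bounded_iff)
    \<comment> \<open>The maximum with 1 keeps \<open>B\<close> positive even when \<open>g\<close>
      vanishes, as the tail bound demands.\<close>
    then show thesis by (intro that[of "max b 1"]) (auto simp: le_max_iff_disj)
  qed
  define k where "k = (card F)\<^sup>2 + 1"
  have close: "AE x in Omega_measure G. \<forall>\<^sub>F n in sequentially.
      \<bar>(\<Sum>\<delta>\<in>D n. g (shift G \<delta> x)) / card (D n) - \<mu>\<bar> < \<epsilon>" if e: "\<epsilon> > 0" for \<epsilon> :: real
  proof -
    define c where "c = \<epsilon>\<^sup>2 / (2 * (real k)\<^sup>2 * B\<^sup>2)"
    have "k > 0" by (simp add: k_def)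
    then have c: "c > 0" using e B(1) by (simp add: c_def)
    \<comment> \<open>The deviation is stated with the cardinality multiplied out, in the form of
      the tail bound; division waits until \<open>rate\<close> gives
      \<open>card (D n) > 0\<close>.\<close>
    define A where "A = (\<lambda>n. {x \<in> space (Omega_measure G).
           \<bar>(\<Sum>\<delta>\<in>D n. g (shift G \<delta> x)) - card (D n) * \<mu>\<bar> \<ge> \<epsilon> * card (D n)})"
    have rate: "\<forall>\<^sub>F n in sequentially. real (card (D n)) > 0 \<and>
        exp (- c * card (D n)) \<le> inverse (real n ^ 2)"
      by (rule eventually_exp_le_inverse_square[OF growth c])
    have [measurable]: "(\<lambda>x. \<Sum>\<delta>\<in>D n. g (shift G \<delta> x)) \<in> borel_measurable (Omega_measure G)" for n
      using D(2)[of n] g(1) by (intro borel_measurable_sum measurable_compose[OF measurable_shift]) auto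
    have "A n \<in> sets (Omega_measure G)" for n unfolding A_def by measurable
    \<comment> \<open>An eventual comparison is used, since early \<open>D n\<close> may be empty
      and the inverse-square rate holds only for large \<open>n\<close>.\<close>
    moreover have "summable (\<lambda>n. measure (Omega_measure G) (A n))"
    proof (rule summable_comparison_test_ev)
      show "summable (\<lambda>n. 2 * real k * inverse (real n ^ 2))"
        by (intro summable_mult inverse_power_summable) auto
      show "\<forall>\<^sub>F n in sequentially. norm (measure (Omega_measure G) (A n)) \<le> 2 * real k * inverse (real n ^ 2)"
        using rate
      proof eventually_elim
        case (elim n)
        have "measure (Omega_measure G) (A n) \<le> 2 * real k * exp (- c * card (D n))"
          unfolding A_def \<mu>_def k_def c_def minus_divide_left
        proof (rule cylinder_avg_tail_bound)
          show "D n \<noteq> {}" using elim by auto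
          show "g x = g y" if "x \<in> space (Omega_measure G)" "y \<in> space (Omega_measure G)"
            "\<And>i. i \<in> F \<Longrightarrow> x i = y i" for x y
            using that by (rule supp)
        qed (fact D g F B e)+
        also have "\<dots> \<le> 2 * real k * inverse (real n ^ 2)"
          using elim by (intro mult_left_mono) auto
        finally show ?case by simp
      qed
    qed
    ultimately have "AE x in Omega_measure G. \<forall>\<^sub>F n in sequentially. x \<in> space (Omega_measure G) - A n"
      by (intro borel_cantelli_AE1) (auto simp: P.emeasure_eq_measure)
    then show ?thesis
    proof eventually_elim
      case (elim x)
      from elim rate show ?case
      proof eventually_elim
        case (elim n)
        have "\<bar>(\<Sum>\<delta>\<in>D n. g (shift G \<delta> x)) - card (D n) * \<mu>\<bar> < \<epsilon> * card (D n)"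
          using elim by (auto simp: A_def)
        moreover have "(\<Sum>\<delta>\<in>D n. g (shift G \<delta> x)) / card (D n) - \<mu>
            = ((\<Sum>\<delta>\<in>D n. g (shift G \<delta> x)) - card (D n) * \<mu>) / card (D n)"
          using elim by (simp add: diff_divide_distrib)
        ultimately show ?case using elim by (simp add: abs_divide pos_divide_less_eq)
      qed
    qed
  qed
  \<comment> \<open>The exceptional null set depends on the tolerance, so only countably many
    tolerances \<open>inverse (Suc m)\<close> are combined.\<close>
  then have "AE x in Omega_measure G. \<forall>m. \<forall>\<^sub>F n in sequentially.
      \<bar>(\<Sum>\<delta>\<in>D n. g (shift G \<delta> x)) / card (D n) - \<mu>\<bar> < inverse (real (Suc m))"
    by (subst AE_all_countable) (simp del: of_nat_Suc)
  then show ?thesis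
  proof eventually_elim
    case (elim x)
    show ?case unfolding \<mu>_def[symmetric]
    proof (rule tendstoI)
      fix e :: real assume "e > 0"
      then obtain m where "inverse (real (Suc m)) < e" using reals_Archimedean by blast
      with elim[rule_format, of m]
      show "\<forall>\<^sub>F n in sequentially. dist ((\<Sum>\<delta>\<in>D n. g (shift G \<delta> x)) / card (D n)) \<mu> < e"
        by (auto elim!: eventually_mono simp: dist_real_def)
    qed
  qed
qed

section \<open>Passage from cylinder functions to continuous functions\<close>

theorem theorem2p1:
  fixes \<Gamma> :: "('g, 'm) monoid_scheme"
    and D :: "nat \<Rightarrow> 'g set"
    and f :: "('g \<Rightarrow> real) \<Rightarrow> complex"
  assumes "group \<Gamma>"
    and "countable (carrier \<Gamma>)" and "infinite (carrier \<Gamma>)"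
    and "\<And>n. finite (D n)" and "\<And>n. D n \<subseteq> carrier \<Gamma>"
    and "filterlim (\<lambda>n. real (card (D n)) / ln (real n)) at_top sequentially"
    and "continuous_map (Omega_top \<Gamma>) euclidean f"
  shows "AE x in Omega_measure \<Gamma>. (\<lambda>n. pointwise_avg \<Gamma> (D n) f x) \<longlonglongrightarrow> global_avg \<Gamma> f"
proof -
  let ?M = "Omega_measure \<Gamma>"
  interpret group \<Gamma> by fact
  interpret P: prob_space ?M by (rule prob_space_Omega_measure)
  note D = assms(4,5)
  \<comment> \<open>\<open>Q m g F\<close> says that \<open>g\<close> is a cylinder approximation of
    \<open>f\<close> with uniform error below \<open>inverse (Suc m)\<close>. A sequence of
    approximants keeps the union of their exceptional null sets null.\<close>
  define Q where "Q = (\<lambda>m g F. finite F \<and> F \<subseteq> carrier \<Gamma> \<and> g \<in> borel_measurable ?M \<and>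
      finite (g ` space ?M) \<and>
      (\<forall>x\<in>space ?M. \<forall>y\<in>space ?M. (\<forall>i\<in>F. x i = y i) \<longrightarrow> g x = g y) \<and>
      (\<forall>x\<in>space ?M. dist (f x) (g x) < inverse (real (Suc m))))"
  have "\<exists>g F. Q m g F" for m
  proof (rule continuous_map_cylinder_approx[where f = f and M = "\<lambda>_. unit_lebesgue"
        and T = "\<lambda>_. top_of_set {0..1}" and I = "carrier \<Gamma>" and e = "inverse (real (Suc m))"])
    show "compact_space (product_topology (\<lambda>_. top_of_set {0..1::real}) (carrier \<Gamma>))"
      by (simp add: compact_space_product_topology compact_space_subtopology)
    show "continuous_map (product_topology (\<lambda>_. top_of_set {0..1}) (carrier \<Gamma>)) euclidean f"
      using assms(7) by (simp add: Omega_top_def)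
    show "space unit_lebesgue = topspace (top_of_set {0..1})"
      by (simp add: unit_lebesgue_def space_restrict_space)
    show "U \<in> sets unit_lebesgue" if "openin (top_of_set {0..1}) U" for U
      using that by (rule sets_unit_lebesgue_openin)
    show "inverse (real (Suc m)) > 0" by simp
  next
    fix g F
    assume *: "finite F" "F \<subseteq> carrier \<Gamma>" "g \<in> borel_measurable (PiM (carrier \<Gamma>) (\<lambda>_. unit_lebesgue))"
      "finite (g ` space (PiM (carrier \<Gamma>) (\<lambda>_. unit_lebesgue)))"
      "\<And>x y. x \<in> space (PiM (carrier \<Gamma>) (\<lambda>_. unit_lebesgue)) \<Longrightarrow>
        y \<in> space (PiM (carrier \<Gamma>) (\<lambda>_. unit_lebesgue)) \<Longrightarrow> (\<And>i. i \<in> F \<Longrightarrow> x i = y i) \<Longrightarrow> g x = g y"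
      "\<And>x. x \<in> space (PiM (carrier \<Gamma>) (\<lambda>_. unit_lebesgue)) \<Longrightarrow>
        dist (f x) (g x) < inverse (real (Suc m))"
    have "Q m g F"
      unfolding Q_def Omega_measure_def
    proof (intro conjI ballI impI)
      show "g x = g y" if "x \<in> space (PiM (carrier \<Gamma>) (\<lambda>_. unit_lebesgue))"
        "y \<in> space (PiM (carrier \<Gamma>) (\<lambda>_. unit_lebesgue))" "\<forall>i\<in>F. x i = y i" for x y
        by (rule *(5)) (use that in blast)+
    qed (fact *)+
    then show "\<exists>g F. Q m g F" by blast
  qed
  then obtain g F where "\<And>m. Q m (g m) (F m)" by metis
  then have F: "\<And>m. finite (F m)" "\<And>m. F m \<subseteq> carrier \<Gamma>"
    and g_meas[measurable]: "\<And>m. g m \<in> borel_measurable ?M" and g_fin: "\<And>m. finite (g m ` space ?M)"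
    and supp: "\<And>m x y. x \<in> space ?M \<Longrightarrow> y \<in> space ?M \<Longrightarrow> (\<And>i. i \<in> F m \<Longrightarrow> x i = y i) \<Longrightarrow> g m x = g m y"
    and approx: "\<And>m x. x \<in> space ?M \<Longrightarrow> dist (f x) (g m x) < inverse (real (Suc m))"
    unfolding Q_def by blast+
  have g_int: "integrable ?M (g m)" for m
  proof -
    obtain b where "\<forall>y\<in>g m ` space ?M. norm y \<le> b"
      using finite_imp_bounded[OF g_fin] by (auto simp: bounded_iff)
    then show ?thesis by (intro P.integrable_const_bound[of _ b]) auto
  qed
  \<comment> \<open>Continuity of \<open>f\<close> refers to the product topology, whereas
    measurability refers to the product sigma-algebra; the measurable \<open>g m\<close>, converging
    pointwise to \<open>f\<close>, connect the two.\<close>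
  have "f \<in> borel_measurable ?M"
  proof (rule borel_measurable_LIMSEQ_metric)
    fix x assume x: "x \<in> space ?M"
    show "(\<lambda>m. g m x) \<longlonglongrightarrow> f x"
    proof (rule metric_LIMSEQ_I)
      fix r :: real assume "r > 0"
      then obtain N where N: "inverse (real (Suc N)) < r" using reals_Archimedean by blast
      show "\<exists>no. \<forall>n\<ge>no. dist (g n x) (f x) < r"
      proof (intro exI allI impI)
        fix n assume "n \<ge> N"
        then have "inverse (real (Suc n)) \<le> inverse (real (Suc N))" by (intro le_imp_inverse_le) auto
        then show "dist (g n x) (f x) < r"
          using approx[OF x, of n] N unfolding dist_commute[of "g n x"] by linarith
      qed
    qed
  qed (rule g_meas)
  have f_int: "integrable ?M f"
  proof -
    \<comment> \<open>At \<open>m = 0\<close> the error is below 1, so \<open>f\<close> is a bounded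
      perturbation of the integrable \<open>g 0\<close>.\<close>
    have "integrable ?M (\<lambda>x. f x - g 0 x)"
    proof (rule P.integrable_const_bound[of _ 1])
      show "AE x in ?M. norm (f x - g 0 x) \<le> 1"
        using approx[of _ 0] by (intro AE_I2) (auto simp: dist_norm intro: less_imp_le)
    qed (use \<open>f \<in> borel_measurable ?M\<close> in simp)
    from Bochner_Integration.integrable_add[OF this g_int[of 0]] show ?thesis by simp
  qed
  have avg_close: "dist (pointwise_avg \<Gamma> (D n) f x) (pointwise_avg \<Gamma> (D n) (g m) x) \<le> inverse (real (Suc m))"
    if "x \<in> space ?M" for n m x
  proof -
    have "norm (\<Sum>\<delta>\<in>D n. f (shift \<Gamma> \<delta> x) - g m (shift \<Gamma> \<delta> x)) \<le> card (D n) * inverse (real (Suc m))"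
    proof (rule sum_norm_bound)
      fix \<delta> assume "\<delta> \<in> D n"
      then have "shift \<Gamma> \<delta> x \<in> space ?M"
        using D(2)[of n] that shift_in_Omega by (auto simp: space_Omega_measure)
      then show "norm (f (shift \<Gamma> \<delta> x) - g m (shift \<Gamma> \<delta> x)) \<le> inverse (real (Suc m))"
        using approx[of "shift \<Gamma> \<delta> x" m] by (simp add: dist_norm)
    qed
    moreover have "pointwise_avg \<Gamma> (D n) f x - pointwise_avg \<Gamma> (D n) (g m) x
        = (\<Sum>\<delta>\<in>D n. f (shift \<Gamma> \<delta> x) - g m (shift \<Gamma> \<delta> x)) / of_nat (card (D n))"
      by (simp add: pointwise_avg_def sum_subtractf diff_divide_distrib)
    ultimately have "dist (pointwise_avg \<Gamma> (D n) f x) (pointwise_avg \<Gamma> (D n) (g m) x)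
        \<le> card (D n) * inverse (real (Suc m)) / card (D n)"
      unfolding dist_norm by (simp only: norm_divide norm_of_nat divide_right_mono of_nat_0_le_iff)
    \<comment> \<open>Only an inequality in general: for empty \<open>D n\<close> the left side is
      0.\<close>
    also have "\<dots> \<le> inverse (real (Suc m))" by simp
    finally show ?thesis .
  qed
  have int_close: "dist (global_avg \<Gamma> f) (global_avg \<Gamma> (g m)) \<le> inverse (real (Suc m))" for m
  proof -
    have "norm (\<integral>x. f x - g m x \<partial>?M) \<le> (\<integral>x. norm (f x - g m x) \<partial>?M)"
      by (rule integral_norm_bound)
    also have "\<dots> \<le> (\<integral>x. inverse (real (Suc m)) \<partial>?M)"
      using f_int g_int approx by (intro integral_mono) (auto simp: dist_norm intro: less_imp_le)
    finally show ?thesis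
      using f_int g_int by (simp add: dist_norm global_avg_def P.prob_space)
  qed
  have lim: "AE x in ?M. (\<lambda>n. pointwise_avg \<Gamma> (D n) (g m) x) \<longlonglongrightarrow> global_avg \<Gamma> (g m)" for m
  proof -
    \<comment> \<open>The convergence result for cylinder functions is real-valued, so it is applied
      to the real and imaginary parts of \<open>g m\<close>.\<close>
    have part: "AE x in ?M. (\<lambda>n. (\<Sum>\<delta>\<in>D n. h (g m (shift \<Gamma> \<delta> x))) / card (D n)) \<longlonglongrightarrow> (\<integral>x. h (g m x) \<partial>?M)"
      if h: "h \<in> borel_measurable borel" for h :: "complex \<Rightarrow> real"
    proof (rule AE_cylinder_avg_tendsto[OF assms(1) D assms(6) _ _ F[of m]])
      show "(\<lambda>x. h (g m x)) \<in> borel_measurable ?M" using h by measurable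
      have "finite (h ` g m ` space ?M)" using g_fin by blast
      then show "finite ((\<lambda>x. h (g m x)) ` space ?M)" by (simp add: image_image)
      show "h (g m x) = h (g m y)" if "x \<in> space ?M" "y \<in> space ?M" "\<And>i. i \<in> F m \<Longrightarrow> x i = y i" for x y
        using supp[OF that] by simp
    qed
    have [measurable]: "Re \<in> borel_measurable borel" "Im \<in> borel_measurable borel"
      by (simp_all add: borel_measurable_continuous_onI continuous_on_Re continuous_on_Im)
    show ?thesis
      using part[of Re] part[of Im]
      by (simp add: tendsto_complex_iff pointwise_avg_def global_avg_def g_int Re_divide_of_nat Im_divide_of_nat)
  qed
  then have "AE x in ?M. \<forall>m. (\<lambda>n. pointwise_avg \<Gamma> (D n) (g m) x) \<longlonglongrightarrow> global_avg \<Gamma> (g m)"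
    by (simp add: AE_all_countable)
  then show ?thesis
    using AE_space
  proof eventually_elim
    case (elim x)
    show ?case
    proof (rule tendstoI)
      fix e :: real assume "e > 0"
      \<comment> \<open>The three thirds pay for replacing \<open>f\<close> by \<open>g m\<close> in
        the pointwise average, for the convergence for \<open>g m\<close>, and for replacing
        \<open>g m\<close> by \<open>f\<close> in the global average. The first and third bounds are
        uniform in \<open>n\<close>.\<close>
      then obtain m where m: "inverse (real (Suc m)) < e / 3" using reals_Archimedean[of "e / 3"] by auto
      have "\<forall>\<^sub>F n in sequentially. dist (pointwise_avg \<Gamma> (D n) (g m) x) (global_avg \<Gamma> (g m)) < e / 3"
        using elim(1) \<open>e > 0\<close> by (intro tendstoD) auto
      then show "\<forall>\<^sub>F n in sequentially. dist (pointwise_avg \<Gamma> (D n) f x) (global_avg \<Gamma> f) < e"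
      proof eventually_elim
        case (elim n)
        have "dist (pointwise_avg \<Gamma> (D n) f x) (global_avg \<Gamma> f)
            \<le> dist (pointwise_avg \<Gamma> (D n) f x) (pointwise_avg \<Gamma> (D n) (g m) x)
              + dist (pointwise_avg \<Gamma> (D n) (g m) x) (global_avg \<Gamma> (g m))
              + dist (global_avg \<Gamma> f) (global_avg \<Gamma> (g m))"
          by metric
        then show ?case
          using avg_close[OF \<open>x \<in> space ?M\<close>, of n m] int_close[of m] m elim by linarith
      qed
    qed
  qed
qed

end
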